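(* Let $k$ be a positive integer, and let $\alpha^*$ be the unique root in $[1/2,1]$ of the equation $$\alpha = (2-2\alpha)\left(1+ \sum^k_{i=0} \frac{1}{i!}\left(\ln \frac{1}{2-2\alpha}\right)^i\right).$$ Then $c_k \leq \alpha^*$.
   Context: A subset $A$ of an additive group is called sumfree if $x+y\neq z$ for all $x,y,z\in A$ (not necessarily distinct). For a positive integer $k$, subsets of $\{1,\ldots,n\}^k$ are regarded as subsets of the additive group $\mathbb{Z}^k$, and $$c_k := \limsup_{n \to \infty} \frac{1}{n^k} \max \{\#S : S \subset \{1,\ldots,n\}^k \text{ is sumfree}\}.$$ At $\alpha=1$ the right-hand side of the equation is interpreted as its limit $0$ as $\alpha\to 1^-$ (so $\alpha = 1$ is not a root). *)

theory Defs
  imports "HOL-Analysis.Analysis"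
begin

definition sumfree :: "'a::ab_group_add set \<Rightarrow> bool" where
  "sumfree A \<longleftrightarrow> (\<forall>x\<in>A. \<forall>y\<in>A. \<forall>z\<in>A. x + y \<noteq> z)"

definition grid :: "nat \<Rightarrow> (int ^ 'k::finite) set" where
  "grid n = {x. \<forall>i. x $ i \<in> {1..int n}}"

definition max_sumfree :: "'k::finite itself \<Rightarrow> nat \<Rightarrow> nat" where
  "max_sumfree _ n = Max {card S | S :: (int ^ 'k) set. S \<subseteq> grid n \<and> sumfree S}"

text \<open>The constant \<open>c\<^sub>k\<close> for \<open>k = CARD('k)\<close>. It is valued in \<^typ>\<open>ereal\<close> only because
  \<^const>\<open>limsup\<close> requires a complete lattice.\<close>

definition sumfree_density :: "'k::finite itself \<Rightarrow> ereal" where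
  "sumfree_density K =
     limsup (\<lambda>n. ereal (1 / real n ^ CARD('k) * real (max_sumfree K n)))"

definition alpha_rhs :: "nat \<Rightarrow> real \<Rightarrow> real" where
  "alpha_rhs k \<alpha> =
     (2 - 2 * \<alpha>) * (1 + (\<Sum>i=0..k. 1 / fact i * (ln (1 / (2 - 2 * \<alpha>))) ^ i))"

text \<open>At \<open>\<alpha> = 1\<close> the right-hand side has the value \<open>0\<close>, which is also its limit as
  \<open>\<alpha>\<close> tends to \<open>1\<close> from below, so \<open>\<alpha> = 1\<close> is not a root.\<close>

lemma alpha_rhs_1: "alpha_rhs k 1 = 0"
  by (simp add: alpha_rhs_def)

definition is_alpha_root :: "nat \<Rightarrow> real \<Rightarrow> bool" where
  "is_alpha_root k \<alpha> \<longleftrightarrow> \<alpha> \<in> {1/2..1} \<and> \<alpha> = alpha_rhs k \<alpha>"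

definition alpha_star :: "nat \<Rightarrow> real" where
  "alpha_star k = (THE \<alpha>. is_alpha_root k \<alpha>)"

end

theory Submission
  imports Defs
begin

text \<open>
  Write \<open>k = CARD('k)\<close>. If \<open>S\<close> is sumfree in the grid and \<open>z \<in> S\<close>, then \<open>x\<close> and \<open>z - x\<close> never
  both lie in \<open>S\<close>, so \<open>S\<close> misses at least half of the box below \<open>z\<close>; hence
  \<open>(\<Prod>i. z\<^sub>i - 1) \<le> 2 * (n ^ k - card S)\<close>. If \<open>card S > \<alpha> * n ^ k\<close> for the root \<open>\<alpha>\<close>, then all of \<open>S\<close>
  lies in the hyperbolic region \<open>(\<Prod>i. z\<^sub>i - 1) \<le> \<beta> * n ^ k\<close> with \<open>\<beta> = 2 - 2 * \<alpha>\<close>. Up to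
  \<open>k * n ^ (k - 1)\<close> points this region has at most \<open>n ^ k * \<beta> * (\<Sum>i\<le>k. ln (1 / \<beta>) ^ i / i!)\<close>
  points, which equals \<open>n ^ k * (\<alpha> - \<beta>)\<close> by the equation for \<open>\<alpha>\<close>. The spare \<open>\<beta> * n ^ k\<close> absorbs
  the error term as soon as \<open>\<beta> * n \<ge> k\<close>, which is a contradiction.

  For the uniqueness of the root put \<open>\<alpha> = 1 - exp (- y) / 2\<close>: the equation becomes
  \<open>3 / 2 * exp (- y) + exp (- y) * (\<Sum>i\<le>k. y ^ i / i!) = 1\<close>, whose left-hand side is strictly
  decreasing for \<open>y \<ge> 0\<close>.
\<close>

section \<open>Truncated exponential series\<close>

text \<open>The Taylor polynomial of \<open>exp\<close> of degree \<open>k\<close>. At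
  \<open>y = ln (1 / (2 - 2 * \<alpha>))\<close> it is the sum in \<open>alpha_rhs\<close>.\<close>

definition exp_partial :: "nat \<Rightarrow> real \<Rightarrow> real" where
  "exp_partial k y = (\<Sum>i=0..k. 1 / fact i * y ^ i)"

lemma exp_partial_0 [simp]: "exp_partial 0 y = 1"
  by (simp add: exp_partial_def)

lemma exp_partial_at_0 [simp]: "exp_partial k 0 = 1"
  by (induction k) (simp_all add: exp_partial_def)

lemma exp_partial_Suc: "exp_partial (Suc k) y = exp_partial k y + y ^ Suc k / fact (Suc k)"
  by (simp add: exp_partial_def)

text \<open>Differentiation shifts the series by one index and so loses the top term. Subtracting
  that term, instead of lowering \<open>k\<close>, keeps the formula valid at
  \<open>k = 0\<close>.\<close>

lemma DERIV_exp_partial: "(exp_partial k has_real_derivative exp_partial k y - y ^ k / fact k) (at y)"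
proof (induction k)
  case 0
  have "exp_partial 0 = (\<lambda>_. 1)" by auto
  then show ?case by simp
next
  case (Suc k)
  have eq: "exp_partial (Suc k) = (\<lambda>y. exp_partial k y + y ^ Suc k / fact (Suc k))"
    using exp_partial_Suc by blast
  have "((\<lambda>y. y ^ Suc k / fact (Suc k)) has_real_derivative real (Suc k) * y ^ k / fact (Suc k)) (at y)"
    using DERIV_cdivide[OF DERIV_pow[of "Suc k" y], of "fact (Suc k)"] by (simp del: fact_Suc)
  also have "real (Suc k) * y ^ k / fact (Suc k) = y ^ k / fact k"
    by (simp add: divide_simps)
  finally have "((\<lambda>y. y ^ Suc k / fact (Suc k)) has_real_derivative y ^ k / fact k) (at y)" .
  from DERIV_add[OF Suc this] show ?case
    unfolding eq by (simp del: fact_Suc)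
qed

lemma DERIV_exp_partial_Suc: "(exp_partial (Suc k) has_real_derivative exp_partial k y) (at y)"
  using DERIV_exp_partial[of "Suc k" y] unfolding exp_partial_Suc by simp

text \<open>By the product rule everything cancels except the lost top term: the derivative is
  \<open>- exp (- u) * u ^ k / fact k\<close>, which is nonpositive for
  \<open>u \<ge> 0\<close>.\<close>

lemma exp_partial_decay_antimono:
  assumes "0 \<le> x" "x \<le> y"
  shows "exp (- y) * exp_partial k y \<le> exp (- x) * exp_partial k x"
proof (rule DERIV_nonpos_imp_nonincreasing[OF assms(2)])
  fix u assume "x \<le> u" "u \<le> y"
  have "((\<lambda>y. exp (- y) * exp_partial k y) has_real_derivative
      exp (- u) * (exp_partial k u - u ^ k / fact k) + (exp (-u) * (-1)) * exp_partial k u) (at u)"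
    by (rule DERIV_mult') (auto intro!: derivative_eq_intros DERIV_exp_partial)
  moreover have "exp (- u) * (exp_partial k u - u ^ k / fact k) + (exp (-u) * (-1)) * exp_partial k u \<le> 0"
    using \<open>x \<le> u\<close> \<open>0 \<le> x\<close> by (simp add: algebra_simps)
  ultimately show "\<exists>D. ((\<lambda>y. exp (- y) * exp_partial k y) has_real_derivative D) (at u) \<and> D \<le> 0"
    by blast
qed

lemma exp_partial_decay_tendsto_0: "((\<lambda>y. exp (- y) * exp_partial k y) \<longlongrightarrow> 0) at_top"
proof -
  have "((\<lambda>y. \<Sum>i=0..k. 1 / fact i * (y ^ i / exp y)) \<longlongrightarrow> (\<Sum>i=0..k. 1 / fact i * (0::real))) at_top"
    by (intro tendsto_intros tendsto_power_div_exp_0)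
  moreover have "(\<lambda>y. \<Sum>i=0..k. 1 / fact i * (y ^ i / exp y)) = (\<lambda>y::real. exp (- y) * exp_partial k y)"
    by (auto simp: exp_partial_def sum_distrib_left exp_minus field_simps)
  ultimately show ?thesis by simp
qed

section \<open>Existence and uniqueness of the root\<close>

lemma alpha_rhs_exp_partial:
  "alpha_rhs k \<alpha> = (2 - 2 * \<alpha>) * (1 + exp_partial k (ln (1 / (2 - 2 * \<alpha>))))"
  by (simp add: alpha_rhs_def exp_partial_def)

text \<open>The substitution \<open>y = ln (1 / (2 - 2 * \<alpha>))\<close> maps the interval from
  \<open>1/2\<close> (included) to \<open>1\<close> (excluded) onto \<open>y \<ge> 0\<close>; the
  endpoint \<open>1\<close> is not a root, so nothing is lost.\<close>

lemma is_alpha_root_iff: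
  "is_alpha_root k \<alpha> \<longleftrightarrow>
    (\<exists>y\<ge>0. \<alpha> = 1 - exp (- y) / 2 \<and> 3 / 2 * exp (- y) + exp (- y) * exp_partial k y = 1)"
proof
  assume root: "is_alpha_root k \<alpha>"
  then have "\<alpha> \<noteq> 1" by (auto simp: is_alpha_root_def alpha_rhs_1)
  with root have range: "1/2 \<le> \<alpha>" "\<alpha> < 1" by (auto simp: is_alpha_root_def)
  define y where "y = ln (1 / (2 - 2 * \<alpha>))"
  have ey: "exp (- y) = 2 - 2 * \<alpha>" using range by (simp add: y_def ln_div)
  have "y \<ge> 0" using range by (simp add: y_def)
  moreover have "\<alpha> = 1 - exp (- y) / 2" using ey by (simp add: field_simps)
  moreover have "\<alpha> = exp (- y) * (1 + exp_partial k y)"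
    unfolding ey using root by (simp add: is_alpha_root_def alpha_rhs_exp_partial y_def)
  ultimately show "\<exists>y\<ge>0. \<alpha> = 1 - exp (- y) / 2 \<and> 3 / 2 * exp (- y) + exp (- y) * exp_partial k y = 1"
    by (intro exI[of _ y]) (simp add: algebra_simps)
next
  assume "\<exists>y\<ge>0. \<alpha> = 1 - exp (- y) / 2 \<and> 3 / 2 * exp (- y) + exp (- y) * exp_partial k y = 1"
  then obtain y where y: "y \<ge> 0" "\<alpha> = 1 - exp (- y) / 2"
    "3 / 2 * exp (- y) + exp (- y) * exp_partial k y = 1" by blast
  have "2 - 2 * \<alpha> = exp (- y)" using y by simp
  then have "alpha_rhs k \<alpha> = exp (- y) * (1 + exp_partial k y)"
    by (simp add: alpha_rhs_exp_partial ln_div)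
  then show "is_alpha_root k \<alpha>"
    using y by (simp add: is_alpha_root_def) (simp add: algebra_simps)
qed

text \<open>The left-hand side \<open>F\<close> falls from \<open>F 0 = 5/2\<close> to the limit
  \<open>0\<close>, so it attains \<open>1\<close> by the intermediate value theorem. It does so
  only once, since the summand \<open>3 / 2 * exp (- y)\<close> makes the decrease strict.\<close>

lemma ex1_alpha_root: "\<exists>!\<alpha>. is_alpha_root k \<alpha>"
proof -
  define F where "F y = 3 / 2 * exp (- y) + exp (- y) * exp_partial k y" for y :: real
  have strict: "F y < F x" if "0 \<le> x" "x < y" for x y
    unfolding F_def using exp_partial_decay_antimono[of x y k] that
    by (intro add_less_le_mono) auto
  have "(F \<longlongrightarrow> 3 / 2 * 0 + 0) at_top"
    unfolding F_def
    by (intro tendsto_intros exp_partial_decay_tendsto_0)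
      (rule filterlim_compose[OF exp_at_bot filterlim_uminus_at_bot_at_top])
  then have "eventually (\<lambda>y. F y < 1) at_top"
    by (intro order_tendstoD) auto
  then obtain b where b: "b \<ge> 0" "F b < 1"
    by (metis eventually_at_top_linorder linorder_linear)
  have "isCont F x" for x
    unfolding F_def
    by (intro continuous_intros DERIV_isCont[OF DERIV_exp_partial])
  then obtain y where y: "y \<ge> 0" "F y = 1"
    using IVT2[of F b 1 0] b by (auto simp: F_def)
  show ?thesis
  proof (rule ex1I[of _ "1 - exp (- y) / 2"])
    show "is_alpha_root k (1 - exp (- y) / 2)"
      unfolding is_alpha_root_iff using y F_def by auto
  next
    fix \<alpha> assume "is_alpha_root k \<alpha>"
    then obtain x where "x \<ge> 0" "\<alpha> = 1 - exp (- x) / 2" "F x = 1"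
      unfolding is_alpha_root_iff F_def by auto
    moreover have "x = y"
      using strict[of x y] strict[of y x] y calculation by fastforce
    ultimately show "\<alpha> = 1 - exp (- y) / 2" by simp
  qed
qed

section \<open>Counting lattice points in a hyperbolic region\<close>

text \<open>Here \<open>\<Psi>\<close> is the antiderivative of the nonincreasing function \<open>\<psi>\<close>.\<close>

lemma sum_exp_partial_le:
  fixes \<tau> :: real and k m :: nat
  defines "\<psi> \<equiv> \<lambda>u. if u \<le> \<tau> then 1 else \<tau> / u * exp_partial k (ln (u / \<tau>))"
  defines "\<Psi> \<equiv> \<lambda>x. if x \<le> \<tau> then x else \<tau> * exp_partial (Suc k) (ln (x / \<tau>))"
  assumes "\<tau> > 0"
  shows "(\<Sum>j=1..m. \<psi> (real j)) \<le> \<Psi> (real m)"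
proof (induction m)
  case 0
  then show ?case using assms by simp
next
  case (Suc m)
  \<comment> \<open>For \<open>y = ln (u / \<tau>)\<close> the factor \<open>\<tau> / u\<close> is
    \<open>exp (- y)\<close>. Hence \<open>exp_partial_decay_antimono\<close> shows both that
    \<open>\<psi>\<close> is nonincreasing beyond \<open>\<tau>\<close> and that it is at most
    \<open>1\<close>, its value at \<open>y = 0\<close>.\<close>
  have decay: "\<tau> / u * exp_partial k (ln (u / \<tau>)) = exp (- ln (u / \<tau>)) * exp_partial k (ln (u / \<tau>))"
    if "u \<ge> \<tau>" for u
    using that \<open>\<tau> > 0\<close> by (simp add: ln_div exp_diff)
  have \<psi>_le_1: "\<psi> u \<le> 1" for u
    using exp_partial_decay_antimono[of 0 "ln (u / \<tau>)" k] decay[of u] \<open>\<tau> > 0\<close>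
    by (simp add: \<psi>_def)
  have right: "(b - a) * \<psi> b \<le> \<Psi> b - \<Psi> a" if ab: "\<tau> \<le> a" "a < b" for a b
  proof -
    \<comment> \<open>The two branches of \<open>\<Psi>\<close> agree at \<open>\<tau>\<close>, so
      the logarithmic one may be used on the closed half-line.\<close>
    have \<Psi>_eq: "\<Psi> x = \<tau> * exp_partial (Suc k) (ln (x / \<tau>))" if "\<tau> \<le> x" for x
      using that \<open>\<tau> > 0\<close> by (cases "x = \<tau>") (auto simp: \<Psi>_def)
    have "((\<lambda>x. \<tau> * exp_partial (Suc k) (ln (x / \<tau>))) has_real_derivative
        \<tau> / u * exp_partial k (ln (u / \<tau>))) (at u)" if "a \<le> u" "u \<le> b" for u
    proof -
      have "((\<lambda>x. exp_partial (Suc k) (ln (x / \<tau>))) has_real_derivative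
          exp_partial k (ln (u / \<tau>)) * (1 / u)) (at u)"
        using that ab \<open>\<tau> > 0\<close>
        by (intro DERIV_chain2[OF DERIV_exp_partial_Suc])
          (auto intro!: derivative_eq_intros simp: field_simps)
      from DERIV_cmult[OF this, of \<tau>] show ?thesis by (simp add: mult_ac)
    qed
    \<comment> \<open>The slope of \<open>\<Psi>\<close> at the intermediate point
      \<open>c < b\<close> is at least \<open>\<psi> b\<close> by monotonicity.\<close>
    from MVT2[OF ab(2) this] obtain c where c: "a < c" "c < b"
      "\<tau> * exp_partial (Suc k) (ln (b / \<tau>)) - \<tau> * exp_partial (Suc k) (ln (a / \<tau>)) =
        (b - a) * (\<tau> / c * exp_partial k (ln (c / \<tau>)))" by blast
    have "\<psi> b \<le> \<tau> / c * exp_partial k (ln (c / \<tau>))"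
      using exp_partial_decay_antimono[of "ln (c / \<tau>)" "ln (b / \<tau>)" k] decay[of b] decay[of c]
        c ab \<open>\<tau> > 0\<close> by (simp add: \<psi>_def divide_right_mono)
    then have "(b - a) * \<psi> b \<le> (b - a) * (\<tau> / c * exp_partial k (ln (c / \<tau>)))"
      using ab by (intro mult_left_mono) auto
    then show ?thesis
      using c ab by (simp only: \<Psi>_eq)
  qed
  have "(b - a) * \<psi> b \<le> \<Psi> b - \<Psi> a" if "a < b" for a b
  proof -
    consider "b \<le> \<tau>" | "\<tau> \<le> a" | "a < \<tau>" "\<tau> < b" by linarith
    then show ?thesis
    proof cases
      case 1
      then show ?thesis using that by (simp add: \<Psi>_def \<psi>_def)
    next
      case 2
      then show ?thesis using right that by blast
    next
      case 3
      \<comment> \<open>The interval is cut at \<open>\<tau>\<close>: to the left of it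
        \<open>\<Psi>\<close> has slope \<open>1\<close>, which is at least
        \<open>\<psi> b\<close>.\<close>
      have "(\<tau> - a) * \<psi> b \<le> \<Psi> \<tau> - \<Psi> a"
        using 3 mult_left_mono[OF \<psi>_le_1[of b], of "\<tau> - a"] by (simp add: \<Psi>_def)
      with right[of \<tau> b] 3 show ?thesis by (simp add: algebra_simps)
    qed
  qed
  from this[of "real m" "real (Suc m)"] Suc show ?case by simp
qed

text \<open>Induction on the index set: fixing the coordinate \<open>w a = j\<close> leaves a
  product of at most \<open>T / j\<close> over the remaining indices. The bounds for these slices
  are summed over \<open>j\<close> by \<open>sum_exp_partial_le\<close>, which raises the degree of
  the polynomial by one.\<close>

lemma card_prod_le:
  fixes n :: nat
  assumes "finite I" "0 < T" "T \<le> real n ^ card I"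
  shows "real (card {w \<in> I \<rightarrow>\<^sub>E {1..n}. real (\<Prod>i\<in>I. w i) \<le> T})
    \<le> T * exp_partial (card I) (ln (real n ^ card I / T))"
  using assms
proof (induction I arbitrary: T rule: finite_induct)
  case empty
  \<comment> \<open>The empty product is \<open>1\<close> and \<open>T \<le> 1\<close>, so the set
    is a singleton for \<open>T = 1\<close> and empty otherwise.\<close>
  then show ?case by (cases "T = 1") (auto simp: PiE_empty_domain)
next
  case (insert a I)
  define C where "C T = {w \<in> I \<rightarrow>\<^sub>E {1..n}. real (\<Prod>i\<in>I. w i) \<le> T}" for T
  define k where "k = card I"
  \<comment> \<open>The threshold for \<open>j\<close>: up to \<open>\<tau>\<close> the bound
    \<open>T / j\<close> is at least \<open>n ^ k\<close>, where the trivial count is used; beyond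
    it the induction hypothesis applies.\<close>
  define \<tau> where "\<tau> = T / real n ^ k"
  have fin: "finite (C T)" for T
    unfolding C_def using insert.hyps by (intro finite_subset[OF _ finite_PiE[of I "\<lambda>_. {1..n}"]]) auto
  have n: "n > 0" using insert.prems insert.hyps by (cases n) auto
  then have "\<tau> > 0" using insert.prems by (simp add: \<tau>_def)
  have "\<tau> \<le> n" using insert.prems insert.hyps n by (simp add: \<tau>_def k_def field_simps)
  have C_le: "real (card (C (T / j))) \<le>
      real n ^ k * (if real j \<le> \<tau> then 1 else \<tau> / j * exp_partial k (ln (j / \<tau>)))"
    if "j > 0" for j :: nat
  proof (cases "real j \<le> \<tau>")
    case True
    have "card (C (T / j)) \<le> card (I \<rightarrow>\<^sub>E {1..n})"
      unfolding C_def using insert.hyps by (intro card_mono finite_PiE) auto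
    also have "\<dots> = n ^ k" using insert.hyps by (simp add: card_PiE k_def)
    finally have "real (card (C (T / j))) \<le> real n ^ k" by (metis of_nat_le_iff of_nat_power)
    then show ?thesis using True by simp
  next
    case False
    then have "T / j \<le> real n ^ k" using that n by (simp add: \<tau>_def field_simps)
    then have "real (card (C (T / j))) \<le> T / j * exp_partial k (ln (real n ^ k / (T / j)))"
      unfolding C_def k_def using insert.IH[of "T / j"] insert.prems that by simp
    also have "real n ^ k / (T / j) = j / \<tau>" by (simp add: \<tau>_def)
    also have "T / j * exp_partial k (ln (j / \<tau>)) = real n ^ k * (\<tau> / j) * exp_partial k (ln (j / \<tau>))" using n by (simp add: \<tau>_def)
    finally show ?thesis using False by (simp only: mult.assoc if_False)
  qed
  have "{w \<in> insert a I \<rightarrow>\<^sub>E {1..n}. real (\<Prod>i\<in>insert a I. w i) \<le> T} \<subseteq>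
      (\<lambda>(j, w). w(a := j)) ` (SIGMA j:{1..n}. C (T / j))"
  proof (rule subsetI)
    fix w assume w: "w \<in> {w \<in> insert a I \<rightarrow>\<^sub>E {1..n}. real (\<Prod>i\<in>insert a I. w i) \<le> T}"
    have "(\<Prod>i\<in>I. real ((w(a := undefined)) i)) = (\<Prod>i\<in>I. real (w i))"
      using insert.hyps by (intro prod.cong) auto
    moreover have "w a \<ge> 1" using w by (auto simp: PiE_iff)
    \<comment> \<open>Resetting the value at \<open>a\<close> to \<open>undefined\<close> makes the
      restriction to \<open>I\<close> extensional, as membership in \<open>C\<close>
      demands.\<close>
    ultimately have "w(a := undefined) \<in> C (T / w a)"
      using w insert.hyps by (auto simp: C_def PiE_iff extensional_def field_simps)
    then show "w \<in> (\<lambda>(j, w). w(a := j)) ` (SIGMA j:{1..n}. C (T / j))"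
      using w by (intro image_eqI[of _ _ "(w a, w(a := undefined))"]) (auto simp: PiE_iff)
  qed
  then have "card {w \<in> insert a I \<rightarrow>\<^sub>E {1..n}. real (\<Prod>i\<in>insert a I. w i) \<le> T}
      \<le> card (SIGMA j:{1..n}. C (T / j))"
    by (intro surj_card_le finite_SigmaI fin) auto
  also have "\<dots> = (\<Sum>j=1..n. card (C (T / j)))"
    using fin by (simp add: card_SigmaI)
  finally have "real (card {w \<in> insert a I \<rightarrow>\<^sub>E {1..n}. real (\<Prod>i\<in>insert a I. w i) \<le> T})
      \<le> (\<Sum>j=1..n. real (card (C (T / j))))"
    by (simp flip: of_nat_sum)
  also have "\<dots> \<le> (\<Sum>j=1..n. real n ^ k *
      (if real j \<le> \<tau> then 1 else \<tau> / j * exp_partial k (ln (j / \<tau>))))"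
    by (intro sum_mono C_le) auto
  also have "\<dots> \<le> real n ^ k *
      (if real n \<le> \<tau> then real n else \<tau> * exp_partial (Suc k) (ln (n / \<tau>)))"
    unfolding sum_distrib_left[symmetric]
    by (intro mult_left_mono sum_exp_partial_le \<open>\<tau> > 0\<close>) auto
  also have "\<dots> = real n ^ k * \<tau> * exp_partial (Suc k) (ln (n / \<tau>))"
    using \<open>\<tau> \<le> n\<close> \<open>\<tau> > 0\<close> by (cases "real n = \<tau>") auto
  also have "real n ^ k * \<tau> = T" using n by (simp add: \<tau>_def)
  also have "n / \<tau> = real n ^ Suc k / T" by (simp add: \<tau>_def mult.commute)
  finally show ?case using insert.hyps by (simp add: k_def)
qed

section \<open>Boxes of integer vectors\<close>

text \<open>Transfers cardinality and finiteness from products of sets to boxes of vectors.\<close>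

lemma bij_betw_vec_PiE:
  "bij_betw (\<lambda>x i. x $ i) {x :: 'a ^ 'k::finite. \<forall>i. x $ i \<in> A i} (PiE UNIV A)"
  by (rule bij_betw_byWitness[where f' = vec_lambda]) (auto simp: vec_eq_iff)

lemma card_vec_box:
  "card {x :: 'a ^ 'k::finite. \<forall>i. x $ i \<in> A i} = (\<Prod>i\<in>UNIV. card (A i))"
  using bij_betw_same_card[OF bij_betw_vec_PiE[of A]] by (simp add: card_PiE)

lemma finite_vec_box:
  assumes "\<And>i. finite (A i)"
  shows "finite {x :: 'a ^ 'k::finite. \<forall>i. x $ i \<in> A i}"
  using bij_betw_finite[OF bij_betw_vec_PiE[of A]] assms finite_PiE[of UNIV A] by simp

lemma finite_grid: "finite (grid n)"
  unfolding grid_def by (rule finite_vec_box) simp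

lemma card_grid: "card (grid n :: (int ^ 'k::finite) set) = n ^ CARD('k)"
  unfolding grid_def card_vec_box by simp

section \<open>Sumfree sets in the grid\<close>

text \<open>The reflection \<open>x \<mapsto> z - x\<close> of the box below \<open>z\<close> maps \<open>S\<close> into its complement.\<close>

lemma sumfree_prod_le:
  fixes S :: "(int ^ 'k::finite) set"
  assumes S: "S \<subseteq> grid n" "sumfree S" and z: "z \<in> S"
  shows "real_of_int (\<Prod>i\<in>UNIV. z $ i - 1) \<le> 2 * (real n ^ CARD('k) - real (card S))"
proof -
  \<comment> \<open>The upper bound \<open>z $ i - 1\<close> keeps every coordinate of
    \<open>z - x\<close> at least \<open>1\<close>, so the reflection preserves
    \<open>B\<close>.\<close>
  define B where "B = {x :: int ^ 'k. \<forall>i. x $ i \<in> {1..z $ i - 1}}"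
  have z1: "z $ i \<in> {1..int n}" for i using S z by (auto simp: grid_def)
  have finB: "finite B" unfolding B_def by (rule finite_vec_box) simp
  have finS: "finite S" using S finite_grid finite_subset by blast
  have B_grid: "B \<subseteq> grid n"
  proof
    fix x assume "x \<in> B"
    then have "1 \<le> x $ i \<and> x $ i \<le> int n" for i
      using z1[of i] unfolding B_def by (auto dest!: spec[of _ i])
    then show "x \<in> grid n" by (simp add: grid_def)
  qed
  have "int (card B) = (\<Prod>i\<in>UNIV. z $ i - 1)"
    unfolding B_def card_vec_box using z1 by (auto simp: of_nat_prod int_one_le_iff_zero_less[symmetric] intro!: prod.cong)
  then have cardB: "real (card B) = real_of_int (\<Prod>i\<in>UNIV. z $ i - 1)"
    by (metis of_int_of_nat_eq)
  have "card (S \<inter> B) + card ((\<lambda>x. z - x) ` (S \<inter> B)) = card (S \<inter> B \<union> (\<lambda>x. z - x) ` (S \<inter> B))"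
  proof (rule card_Un_disjoint[symmetric])
    show "(S \<inter> B) \<inter> (\<lambda>x. z - x) ` (S \<inter> B) = {}"
    proof (rule ccontr)
      assume "(S \<inter> B) \<inter> (\<lambda>x. z - x) ` (S \<inter> B) \<noteq> {}"
      then obtain x where "x \<in> S" "z - x \<in> S" by blast
      moreover have "x + (z - x) = z" by simp
      ultimately show False using S(2) z unfolding sumfree_def by blast
    qed
  qed (use finB in auto)
  also have "\<dots> \<le> card B"
  proof (rule card_mono[OF finB])
    have "z - x \<in> B" if "x \<in> B" for x
    proof -
      have "1 \<le> x $ i \<and> x $ i \<le> z $ i - 1" for i using that by (simp add: B_def)
      then have "1 \<le> z $ i - x $ i \<and> z $ i - x $ i \<le> z $ i - 1" for i
        by (auto simp: algebra_simps)
      then show ?thesis by (simp add: B_def)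
    qed
    then show "S \<inter> B \<union> (\<lambda>x. z - x) ` (S \<inter> B) \<subseteq> B" by blast
  qed
  finally have half: "2 * card (S \<inter> B) \<le> card B"
    by (simp add: card_image inj_on_def)
  \<comment> \<open>Inclusion-exclusion within the grid; \<open>half\<close> then bounds the overlap
    by half of \<open>card B\<close>.\<close>
  have "card S - card (S \<inter> B) + card B = card (S \<union> B)"
    using card_Un_Int[OF finS finB] card_mono[OF finS, of "S \<inter> B"] by simp
  also have "\<dots> \<le> card (grid n :: (int ^ 'k) set)"
    using S B_grid by (intro card_mono finite_grid) auto
  finally have "card S + card B \<le> n ^ CARD('k) + card (S \<inter> B)"
    by (simp add: card_grid)
  with half have "card B + 2 * card S \<le> 2 * n ^ CARD('k)" by linarith
  then have "real (card B + 2 * card S) \<le> real (2 * n ^ CARD('k))" by (simp only: of_nat_le_iff)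
  with cardB show ?thesis by simp
qed

text \<open>The term \<open>CARD('k) * n ^ (CARD('k) - 1)\<close> accounts for the points at which the product vanishes.\<close>

lemma card_grid_prod_le:
  assumes "0 < T" "T \<le> real n ^ CARD('k::finite)"
  shows "real (card {z \<in> grid n :: (int ^ 'k) set. real_of_int (\<Prod>i\<in>UNIV. z $ i - 1) \<le> T})
    \<le> T * exp_partial CARD('k) (ln (real n ^ CARD('k) / T)) + CARD('k) * real n ^ (CARD('k) - 1)"
proof -
  define A where "A = {z \<in> grid n :: (int ^ 'k) set. real_of_int (\<Prod>i\<in>UNIV. z $ i - 1) \<le> T}"
  define P where "P = {w \<in> (UNIV :: 'k set) \<rightarrow>\<^sub>E {1..n}. real (\<Prod>i\<in>UNIV. w i) \<le> T}"
  \<comment> \<open>The grid points with \<open>i\<close>-th coordinate \<open>1\<close>, at which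
    the product vanishes. Off all faces, the shift \<open>f\<close> by one in each coordinate lands
    in the range of \<open>card_prod_le\<close>.\<close>
  define face where "face i = {z :: int ^ 'k. \<forall>j. z $ j \<in> (if j = i then {1} else {1..int n})}" for i
  define f where "f z = (\<lambda>i. nat (z $ i - 1))" for z :: "int ^ 'k"
  have finP: "finite P" unfolding P_def
    by (intro finite_subset[OF _ finite_PiE[of UNIV "\<lambda>_. {1..n}"]]) auto
  have card_face: "card (face i) = n ^ (CARD('k) - 1)" for i
  proof -
    have "card (face i) = (\<Prod>j\<in>UNIV. if j = i then 1 else n)"
      unfolding face_def card_vec_box by (intro prod.cong) auto
    also have "\<dots> = (\<Prod>j\<in>UNIV - {i}. n)"
      by (subst prod.remove[of _ i]) (auto intro!: prod.cong)
    finally show ?thesis by (simp add: card_Diff_singleton)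
  qed
  have in_grid: "1 \<le> z $ i \<and> z $ i \<le> int n" if "z \<in> grid n" for z :: "int ^ 'k" and i
    using that by (auto simp: grid_def)
  have sub: "A - \<Union>(range face) \<subseteq> {z \<in> A. \<forall>i. 2 \<le> z $ i}"
  proof (rule subsetI)
    fix z assume z: "z \<in> A - \<Union>(range face)"
    have zg: "z \<in> grid n" using z by (simp add: A_def)
    have "2 \<le> z $ i" for i
    proof (rule ccontr)
      assume "\<not> 2 \<le> z $ i"
      then have "z $ i = 1" using in_grid[OF zg, of i] by linarith
      then have "z \<in> face i" using in_grid[OF zg] by (simp add: face_def)
      with z show False by blast
    qed
    with z show "z \<in> {z \<in> A. \<forall>i. 2 \<le> z $ i}" by simp
  qed
  have inj: "card {z \<in> A. \<forall>i. 2 \<le> z $ i} \<le> card P"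
  proof (rule card_inj_on_le[OF _ _ finP])
    show "inj_on f {z \<in> A. \<forall>i. 2 \<le> z $ i}"
    proof (rule inj_onI)
      fix x y assume x: "x \<in> {z \<in> A. \<forall>i. 2 \<le> z $ i}" and y: "y \<in> {z \<in> A. \<forall>i. 2 \<le> z $ i}"
        and "f x = f y"
      then have "nat (x $ i - 1) = nat (y $ i - 1)" for i by (metis f_def)
      moreover have "2 \<le> x $ i" "2 \<le> y $ i" for i using x y by auto
      ultimately have "x $ i = y $ i" for i
        by (metis (no_types) diff_add_cancel diff_ge_0_iff_ge eq_nat_nat_iff one_le_numeral order_trans)
      then show "x = y" by (simp add: vec_eq_iff)
    qed
    show "f ` {z \<in> A. \<forall>i. 2 \<le> z $ i} \<subseteq> P"
    proof (rule image_subsetI)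
      fix z assume z: "z \<in> {z \<in> A. \<forall>i. 2 \<le> z $ i}"
      then have zg: "z \<in> grid n" and z2: "\<And>i. 2 \<le> z $ i" by (auto simp: A_def)
      have nonneg: "0 \<le> z $ i - 1" for i using z2[of i] by linarith
      have "real (\<Prod>i\<in>UNIV. f z i) = real_of_int (\<Prod>i\<in>UNIV. z $ i - 1)"
        unfolding of_nat_prod of_int_prod f_def
        by (intro prod.cong) (use nonneg in simp_all)
      moreover have "f z i \<in> {1..n}" for i
        using z2[of i] in_grid[OF zg, of i] by (auto simp: f_def)
      ultimately show "f z \<in> P" using z by (auto simp: P_def A_def)
    qed
  qed
  have finA: "finite A" unfolding A_def by (simp add: finite_grid)
  then have "card (A - \<Union>(range face)) \<le> card {z \<in> A. \<forall>i. 2 \<le> z $ i}"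
    by (intro card_mono sub) simp
  with inj have main: "card (A - \<Union>(range face)) \<le> card P" by linarith
  have "finite (face i)" for i unfolding face_def by (rule finite_vec_box) simp
  then have "finite (\<Union>(range face))" by simp
  then have "card A \<le> card (A - \<Union>(range face)) + card (\<Union>(range face))"
    using finA by (intro order_trans[OF card_mono card_Un_le]) auto
  also have "card (\<Union>(range face)) \<le> (\<Sum>i\<in>UNIV. card (face i))"
    by (rule card_UN_le) simp
  also have "\<dots> = CARD('k) * n ^ (CARD('k) - 1)" by (simp add: card_face)
  finally have "card A \<le> card P + CARD('k) * n ^ (CARD('k) - 1)" using main by linarith
  then have "real (card A) \<le> real (card P) + CARD('k) * real n ^ (CARD('k) - 1)"
    by (metis of_nat_add of_nat_le_iff of_nat_mult of_nat_power)
  moreover have "real (card P) \<le> T * exp_partial CARD('k) (ln (real n ^ CARD('k) / T))"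
    unfolding P_def using card_prod_le[of "UNIV :: 'k set" T n] assms by simp
  ultimately show ?thesis by (simp add: A_def)
qed

section \<open>The density bound\<close>

text \<open>The bound is exact from an explicit \<open>n\<close> on, so no error term has to be
  carried into the limsup.\<close>

lemma card_sumfree_le:
  fixes S :: "(int ^ 'k::finite) set"
  assumes S: "S \<subseteq> grid n" "sumfree S"
    and root: "is_alpha_root CARD('k) \<alpha>"
    and n: "n > 0" "real CARD('k) \<le> (2 - 2 * \<alpha>) * real n"
  shows "real (card S) \<le> \<alpha> * real n ^ CARD('k)"
proof (rule ccontr)
  assume large: "\<not> real (card S) \<le> \<alpha> * real n ^ CARD('k)"
  define k where "k = CARD('k)"
  define \<beta> where "\<beta> = 2 - 2 * \<alpha>"
  define T where "T = \<beta> * real n ^ k"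
  have "\<alpha> \<noteq> 1" using root by (auto simp: is_alpha_root_def alpha_rhs_1)
  with root have \<beta>: "0 < \<beta>" "\<beta> \<le> 1" by (auto simp: is_alpha_root_def \<beta>_def)
  have T: "0 < T" "T \<le> real n ^ k" using \<beta> n by (auto simp: T_def mult_le_cancel_right1)
  have "S \<subseteq> {z \<in> grid n. real_of_int (\<Prod>i\<in>UNIV. z $ i - 1) \<le> T}"
  proof
    fix z assume "z \<in> S"
    from sumfree_prod_le[OF S this] have "real_of_int (\<Prod>i\<in>UNIV. z $ i - 1) \<le> T"
      using large by (simp add: T_def \<beta>_def k_def algebra_simps)
    with \<open>z \<in> S\<close> S show "z \<in> {z \<in> grid n. real_of_int (\<Prod>i\<in>UNIV. z $ i - 1) \<le> T}" by blast
  qed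
  then have "card S \<le> card {z \<in> grid n :: (int ^ 'k) set. real_of_int (\<Prod>i\<in>UNIV. z $ i - 1) \<le> T}"
    by (intro card_mono) (auto simp: finite_grid)
  also have "real \<dots> \<le> T * exp_partial k (ln (real n ^ k / T)) + k * real n ^ (k - 1)"
    unfolding k_def using T card_grid_prod_le[where 'k = 'k, of T n] by (simp add: k_def)
  also have "real n ^ k / T = 1 / \<beta>" using n by (simp add: T_def)
  also have "T * exp_partial k (ln (1 / \<beta>)) = (\<alpha> - \<beta>) * real n ^ k"
  proof -
    have "\<alpha> = \<beta> * (1 + exp_partial k (ln (1 / \<beta>)))"
      using root by (simp add: is_alpha_root_def alpha_rhs_exp_partial \<beta>_def k_def)
    then have "\<beta> * exp_partial k (ln (1 / \<beta>)) = \<alpha> - \<beta>" by (simp add: algebra_simps)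
    then show ?thesis by (simp add: T_def mult_ac)
  qed
  also have "k * real n ^ (k - 1) \<le> \<beta> * real n * real n ^ (k - 1)"
    using n by (intro mult_right_mono) (auto simp: k_def \<beta>_def)
  also have "\<dots> = \<beta> * real n ^ k"
    by (simp add: k_def power_eq_if)
  finally have "real (card S) \<le> \<alpha> * real n ^ k" by (simp add: algebra_simps)
  with large show False by (simp add: k_def)
qed

theorem theorem1p3:
  shows "(\<exists>!\<alpha>. is_alpha_root CARD('k::finite) \<alpha>) \<and>
         sumfree_density TYPE('k) \<le> ereal (alpha_star CARD('k))"
proof
  show ex1: "\<exists>!\<alpha>. is_alpha_root CARD('k) \<alpha>" by (rule ex1_alpha_root)
  define \<alpha> where "\<alpha> = alpha_star CARD('k)"
  have root: "is_alpha_root CARD('k) \<alpha>"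
    unfolding \<alpha>_def alpha_star_def using ex1 by (rule theI')
  have "\<alpha> \<noteq> 1" using root by (auto simp: is_alpha_root_def alpha_rhs_1)
  with root have pos: "2 - 2 * \<alpha> > 0" by (auto simp: is_alpha_root_def)
  \<comment> \<open>Beyond this \<open>N\<close> the size condition of
    \<open>card_sumfree_le\<close> holds; starting from \<open>Suc N\<close> also gives
    \<open>n > 0\<close>.\<close>
  obtain N where N: "real CARD('k) / (2 - 2 * \<alpha>) \<le> real N" using real_arch_simple by blast
  have "ereal (1 / real n ^ CARD('k) * real (max_sumfree TYPE('k) n)) \<le> ereal \<alpha>"
    if "n \<ge> Suc N" for n
  proof -
    have "finite {card S | S :: (int ^ 'k) set. S \<subseteq> grid n \<and> sumfree S}"
      by (rule finite_subset[of _ "card ` Pow (grid n)"]) (auto simp: finite_grid)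
    \<comment> \<open>The empty set is sumfree, so the maximum is over a nonempty finite set and is
      attained by some \<open>S\<close>.\<close>
    moreover have "card ({} :: (int ^ 'k) set) \<in> {card S | S :: (int ^ 'k) set. S \<subseteq> grid n \<and> sumfree S}"
      by (auto simp: sumfree_def intro!: exI[of _ "{}"])
    ultimately have "max_sumfree TYPE('k) n \<in> {card S | S :: (int ^ 'k) set. S \<subseteq> grid n \<and> sumfree S}"
      unfolding max_sumfree_def by (intro Max_in) auto
    then obtain S :: "(int ^ 'k) set" where S: "S \<subseteq> grid n" "sumfree S"
      "max_sumfree TYPE('k) n = card S" by blast
    have "real CARD('k) \<le> (2 - 2 * \<alpha>) * real N"
      using N pos by (simp add: field_simps)
    also have "\<dots> \<le> (2 - 2 * \<alpha>) * real n"
      using that pos by (intro mult_left_mono) auto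
    finally have "real (card S) \<le> \<alpha> * real n ^ CARD('k)"
      using card_sumfree_le[OF S(1,2) root] that by simp
    then show ?thesis using S(3) that by (simp add: field_simps)
  qed
  then show "sumfree_density TYPE('k) \<le> ereal (alpha_star CARD('k))"
    unfolding sumfree_density_def \<alpha>_def[symmetric]
    by (intro Limsup_bounded) (auto simp: eventually_sequentially)
qed

end
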